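(* Let $\mathcal H$ be a Hilbert space. The spherical Aluthge transform $(T_1,T_2)\mapsto\widehat{(T_1,T_2)}$, defined on commuting pairs of bounded operators on $\mathcal H$, is norm-to-norm continuous: if $(T_1,T_2)$ and $(T_1^{(n)},T_2^{(n)})$, $n\ge1$, are commuting pairs of bounded operators on $\mathcal H$ with $\|T_i^{(n)}-T_i\|\to0$ for $i=1,2$, then $\|\widehat{T_i^{(n)}}-\widehat T_i\|\to0$ for $i=1,2$, where $(\widehat T_1,\widehat T_2)=\widehat{(T_1,T_2)}$ and $(\widehat{T_1^{(n)}},\widehat{T_2^{(n)}})=\widehat{(T_1^{(n)},T_2^{(n)})}$.
   Context: For a commuting pair $(T_1,T_2)$ of bounded operators on a Hilbert space, let $P:=\sqrt{T_1^*T_1+T_2^*T_2}$ and let $(T_1,T_2)=(U_1P,U_2P)$ be its joint polar decomposition, where $U_1,U_2$ are the bounded operators determined by $T_i=U_iP$ and $\ker U_1\cap\ker U_2=\ker P$. The spherical Aluthge transform is $\widehat{(T_1,T_2)}=(\widehat T_1,\widehat T_2):=(\sqrt P\,U_1\sqrt P,\ \sqrt P\,U_2\sqrt P)$. *)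

theory Defs
  imports "HOL-Analysis.Analysis"
begin

text \<open>Complex Hilbert spaces.  The class extends \<^class>\<open>real_inner\<close>, so that the norm,
  the topology and the library type of bounded operators are available; the real inner
  product is the real part of the complex one, which is linear in its first argument.\<close>

class complex_inner = real_inner +
  fixes scaleC :: "complex \<Rightarrow> 'a \<Rightarrow> 'a" (infixr "*\<^sub>C" 75)
    and cinner :: "'a \<Rightarrow> 'a \<Rightarrow> complex"
  assumes scaleC_add_right: "c *\<^sub>C (x + y) = c *\<^sub>C x + c *\<^sub>C y"
    and scaleC_add_left: "(c + d) *\<^sub>C x = c *\<^sub>C x + d *\<^sub>C x"
    and scaleC_scaleC: "c *\<^sub>C d *\<^sub>C x = (c * d) *\<^sub>C x"
    and scaleR_scaleC: "r *\<^sub>R x = complex_of_real r *\<^sub>C x"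
    and cinner_commute: "cinner x y = cnj (cinner y x)"
    and cinner_add_left: "cinner (x + y) z = cinner x z + cinner y z"
    and cinner_scaleC_left: "cinner (c *\<^sub>C x) y = c * cinner x y"
    and inner_Re_cinner: "inner x y = Re (cinner x y)"

class chilbert_space = complex_inner + complete_space

instance chilbert_space \<subseteq> banach ..

instantiation complex :: chilbert_space
begin

definition scaleC_complex :: "complex \<Rightarrow> complex \<Rightarrow> complex"
  where "scaleC_complex c x = c * x"

definition cinner_complex :: "complex \<Rightarrow> complex \<Rightarrow> complex"
  where "cinner_complex x y = x * cnj y"

instance
  by standard
    (simp_all add: scaleC_complex_def cinner_complex_def algebra_simps scaleR_conv_of_real
      inner_complex_def)

end

text \<open>The type \<^typ>\<open>'a \<Rightarrow>\<^sub>L 'a\<close> consists of the bounded real-linear operators, so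
  complex linearity is a separate predicate.  The norm of this type is the operator norm.\<close>

definition clinear_op :: "('a::complex_inner \<Rightarrow>\<^sub>L 'a) \<Rightarrow> bool"
  where "clinear_op T \<longleftrightarrow> (\<forall>c x. blinfun_apply T (c *\<^sub>C x) = c *\<^sub>C blinfun_apply T x)"

definition commuting_pair :: "('a::complex_inner \<Rightarrow>\<^sub>L 'a) \<Rightarrow> ('a \<Rightarrow>\<^sub>L 'a) \<Rightarrow> bool"
  where "commuting_pair T1 T2 \<longleftrightarrow>
    clinear_op T1 \<and> clinear_op T2 \<and> T1 o\<^sub>L T2 = T2 o\<^sub>L T1"

definition op_adjoint :: "('a::chilbert_space \<Rightarrow>\<^sub>L 'a) \<Rightarrow> 'a \<Rightarrow>\<^sub>L 'a"
  where "op_adjoint T =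
    (THE S. \<forall>x y. cinner (blinfun_apply T x) y = cinner x (blinfun_apply S y))"

definition positive_op :: "('a::complex_inner \<Rightarrow>\<^sub>L 'a) \<Rightarrow> bool"
  where "positive_op A \<longleftrightarrow>
    clinear_op A \<and> (\<forall>x. cinner (blinfun_apply A x) x \<in> \<real>\<^sub>\<ge>\<^sub>0)"

definition op_sqrt :: "('a::chilbert_space \<Rightarrow>\<^sub>L 'a) \<Rightarrow> 'a \<Rightarrow>\<^sub>L 'a"
  where "op_sqrt A = (THE R. positive_op R \<and> R o\<^sub>L R = A)"

definition op_ker :: "('a::complex_inner \<Rightarrow>\<^sub>L 'a) \<Rightarrow> 'a set"
  where "op_ker T = {x. blinfun_apply T x = 0}"

definition spherical_modulus ::
    "('a::chilbert_space \<Rightarrow>\<^sub>L 'a) \<Rightarrow> ('a \<Rightarrow>\<^sub>L 'a) \<Rightarrow> 'a \<Rightarrow>\<^sub>L 'a"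
  where "spherical_modulus T1 T2 =
    op_sqrt ((op_adjoint T1 o\<^sub>L T1) + (op_adjoint T2 o\<^sub>L T2))"

text \<open>The kernel condition forces both operators to vanish on the kernel of the modulus, the
  orthogonal complement of its range; this is what makes the pair unique.\<close>

definition joint_polar_part ::
    "('a::chilbert_space \<Rightarrow>\<^sub>L 'a) \<Rightarrow> ('a \<Rightarrow>\<^sub>L 'a) \<Rightarrow> ('a \<Rightarrow>\<^sub>L 'a) \<times> ('a \<Rightarrow>\<^sub>L 'a)"
  where "joint_polar_part T1 T2 =
    (THE U. clinear_op (fst U) \<and> clinear_op (snd U) \<and>
      T1 = fst U o\<^sub>L spherical_modulus T1 T2 \<and>
      T2 = snd U o\<^sub>L spherical_modulus T1 T2 \<and>
      op_ker (fst U) \<inter> op_ker (snd U) = op_ker (spherical_modulus T1 T2))"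

definition spherical_aluthge ::
    "('a::chilbert_space \<Rightarrow>\<^sub>L 'a) \<Rightarrow> ('a \<Rightarrow>\<^sub>L 'a) \<Rightarrow> ('a \<Rightarrow>\<^sub>L 'a) \<times> ('a \<Rightarrow>\<^sub>L 'a)"
  where "spherical_aluthge T1 T2 =
    (let R = op_sqrt (spherical_modulus T1 T2);
         U = joint_polar_part T1 T2
     in (R o\<^sub>L fst U o\<^sub>L R, R o\<^sub>L snd U o\<^sub>L R))"

end

theory Submission
  imports Defs
begin

text \<open>Write \<open>T = U P\<close> for either component and let \<open>R\<close> be the square root of \<open>P\<close>, so that the
  transform is \<open>R U R\<close>.  The square root is norm continuous on positive operators, because the
  square of the norm of \<open>R' - R\<close> is at most the norm of \<open>R'\<^sup>2 - R\<^sup>2\<close> (test the latter on an approximate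
  eigenvector of \<open>R' - R\<close>); hence \<open>P\<close> and \<open>R\<close> depend continuously on the pair.  The polar part \<open>U\<close>
  does not, but \<open>U R\<close> does: for a nearby pair \<open>T' = U' P'\<close> the operator
  \<open>(U' - U) P = (T' - T) - U' (P' - P)\<close> is small, and for \<open>E = U' - U\<close> the square of the norm of \<open>E R\<close>
  is at most the norm of \<open>E P\<close> times that of \<open>E\<close>, which is at most 2.

  Adjoints and the polar part both come from one minimization: a functional \<open>g\<close> dominated by
  the norm of \<open>P w\<close> is represented by a vector in the closure of the range of \<open>P\<close>.\<close>

section \<open>Riesz representation on the range of an operator, and adjoints\<close>

text \<open>The domination lets \<open>g\<close> factor through \<open>P\<close>, and Riesz's
  variational argument then runs on the range of \<open>P\<close>. Along a minimizing sequence of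
  \<open>J\<close> the images under \<open>P\<close> are Cauchy by the parallelogram law, and
  vanishing of the first variation at their limit \<open>u\<close> is the representation. The
  alternative \<open>K < 0\<close> can only occur when \<open>P\<close> is zero everywhere.\<close>

lemma riesz_on_range:
  fixes P :: "'a::real_vector \<Rightarrow> 'b::{real_inner,banach}"
  assumes P: "linear P" and g: "linear g" and K: "\<And>w. \<bar>g w\<bar> \<le> K * norm (P w)"
  obtains u where "u \<in> closure (range P)" "\<And>w. g w = inner (P w) u" "norm u \<le> K \<or> K < 0"
proof -
  \<comment> \<open>If \<open>g w = inner (P w) u\<close>, then \<open>J w\<close> is the squared
    distance from \<open>P w\<close> to \<open>u\<close> minus \<open>(norm u)^2\<close>, so making
    \<open>J\<close> small drives \<open>P w\<close> towards \<open>u\<close>.\<close>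
  define J where "J w = (norm (P w))\<^sup>2 - 2 * g w" for w
  have J_ge: "- K\<^sup>2 \<le> J w" for w
  proof -
    have "0 \<le> (norm (P w) - K)\<^sup>2" by simp
    then show ?thesis using K[of w] by (simp add: J_def power2_eq_square algebra_simps)
  qed
  define j where "j = Inf (range J)"
  have bdd: "bdd_below (range J)" using J_ge by (auto intro!: bdd_belowI)
  have j_le: "j \<le> J w" for w unfolding j_def by (rule cInf_lower[OF _ bdd]) simp
  have "\<exists>w. J w < j + 1 / real (Suc n)" for n
  proof -
    have "Inf (range J) < j + 1 / real (Suc n)" unfolding j_def by simp
    then show ?thesis using cInf_lessD[of "range J"] by blast
  qed
  then obtain w where w: "\<And>n. J (w n) < j + 1 / real (Suc n)" by metis
  \<comment> \<open>Parallelogram law: the value of \<open>J\<close> at the midpoint of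
    \<open>a\<close> and \<open>b\<close> is at least the infimum \<open>j\<close>.\<close>
  have par: "(norm (P a - P b))\<^sup>2 \<le> 2 * (J a - j) + 2 * (J b - j)" for a b
  proof -
    have "(norm (P a - P b))\<^sup>2 = 2 * J a + 2 * J b - 4 * J ((1/2) *\<^sub>R (a + b))"
      by (simp add: J_def linear_add[OF P] linear_scale[OF P] linear_add[OF g] linear_scale[OF g]
          power2_norm_eq_inner inner_add inner_diff inner_commute algebra_simps)
    then show ?thesis using j_le[of "(1/2) *\<^sub>R (a + b)"] by simp
  qed
  have "Cauchy (\<lambda>n. P (w n))"
  proof (rule metric_CauchyI)
    fix e :: real assume "0 < e"
    define d where "d = e * e / 4"
    have d: "0 < d" "e\<^sup>2 = 4 * d" using \<open>0 < e\<close> by (simp_all add: d_def power2_eq_square)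
    obtain N where N: "1 / real (Suc N) < d" using nat_approx_posE[OF d(1)] by blast
    have small: "J (w n) - j < d" if "n \<ge> N" for n
    proof -
      have "1 / real (Suc n) \<le> 1 / real (Suc N)" using that by (simp add: frac_le)
      then show ?thesis using w[of n] N by linarith
    qed
    have "dist (P (w m)) (P (w n)) < e" if "m \<ge> N" "n \<ge> N" for m n
    proof -
      have "(norm (P (w m) - P (w n)))\<^sup>2 < e\<^sup>2"
        using order.strict_trans1[OF par[of "w m" "w n"], of "2 * d + 2 * d"]
          small[OF that(1)] small[OF that(2)] by (simp add: d(2))
      then have "norm (P (w m) - P (w n)) < e"
        by (rule power2_less_imp_less) (use \<open>0 < e\<close> in simp)
      then show ?thesis by (simp add: dist_norm)
    qed
    then show "\<exists>M. \<forall>m\<ge>M. \<forall>n\<ge>M. dist (P (w m)) (P (w n)) < e" by blast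
  qed
  then obtain u where u: "(\<lambda>n. P (w n)) \<longlonglongrightarrow> u"
    using Cauchy_convergent_iff convergent_def by blast
  have Jlim: "(\<lambda>n. J (w n)) \<longlonglongrightarrow> j"
  proof (rule tendsto_sandwich[OF _ _ tendsto_const])
    show "(\<lambda>n. j + 1 / real (Suc n)) \<longlonglongrightarrow> j"
      using tendsto_add[OF tendsto_const[of j] LIMSEQ_inverse_real_of_nat] by (simp add: field_simps)
  qed (use w j_le in \<open>auto intro!: always_eventually less_imp_le\<close>)
  have gu: "g v = inner (P v) u" for v
  proof -
    define b where "b = inner u (P v) - g v"
    \<comment> \<open>Perturb the minimizing sequence in the direction \<open>v\<close> and pass to
      the limit; \<open>2 * b\<close> is the first variation.\<close>
    have quad: "0 \<le> 2 * t * b + t\<^sup>2 * (norm (P v))\<^sup>2" for t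
    proof -
      have "(\<lambda>n. J (w n) + 2 * t * (inner (P (w n)) (P v) - g v) + t\<^sup>2 * (norm (P v))\<^sup>2)
          \<longlonglongrightarrow> j + 2 * t * (inner u (P v) - g v) + t\<^sup>2 * (norm (P v))\<^sup>2"
        by (intro tendsto_intros Jlim u)
      moreover have "J (w n) + 2 * t * (inner (P (w n)) (P v) - g v) + t\<^sup>2 * (norm (P v))\<^sup>2
          = J (w n + t *\<^sub>R v)" for n
        unfolding J_def linear_add[OF P] linear_scale[OF P] linear_add[OF g] linear_scale[OF g]
          power2_norm_eq_inner
        by (simp add: inner_add inner_commute power2_eq_square algebra_simps)
      ultimately have "j \<le> j + 2 * t * (inner u (P v) - g v) + t\<^sup>2 * (norm (P v))\<^sup>2"
        using j_le by (intro LIMSEQ_le_const) auto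
      then show ?thesis by (simp add: b_def)
    qed
    have "b = 0"
    proof (rule ccontr)
      assume "b \<noteq> 0"
      \<comment> \<open>The choice \<open>t = - b / q\<close> nearly minimizes the quadratic; the
        summand 1 keeps \<open>q\<close> positive even when \<open>P v = 0\<close>.\<close>
      define q where "q = (norm (P v))\<^sup>2 + 1"
      have q: "0 < q" by (simp add: q_def add_nonneg_pos)
      have "0 \<le> 2 * (- b / q) * b + (- b / q)\<^sup>2 * (norm (P v))\<^sup>2" by (rule quad)
      also have "\<dots> \<le> 2 * (- b / q) * b + (- b / q)\<^sup>2 * q"
        by (intro add_left_mono mult_left_mono) (auto simp: q_def)
      also have "\<dots> = - (b\<^sup>2 / q)" using q by (simp add: power2_eq_square field_simps)
      also have "\<dots> < 0" using q \<open>b \<noteq> 0\<close> by simp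
      finally show False by simp
    qed
    then show ?thesis by (simp add: b_def inner_commute)
  qed
  have cl: "u \<in> closure (range P)" unfolding closure_sequential
    using u by (intro exI[of _ "\<lambda>n. P (w n)"]) simp
  have "inner u u \<le> K * norm u"
  proof (rule LIMSEQ_le)
    show "(\<lambda>n. inner (P (w n)) u) \<longlonglongrightarrow> inner u u" by (intro tendsto_intros u)
    show "(\<lambda>n. K * norm (P (w n))) \<longlonglongrightarrow> K * norm u" by (intro tendsto_intros u)
    show "\<exists>N. \<forall>n\<ge>N. inner (P (w n)) u \<le> K * norm (P (w n))"
      using K gu by (metis abs_ge_self order_trans)
  qed
  then have "norm u * norm u \<le> K * norm u" by (simp add: power2_norm_eq_inner[symmetric] power2_eq_square)
  then have "norm u \<le> K \<or> K < 0"
    by (cases "u = 0") auto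
  then show ?thesis using that cl gu by blast
qed

lemma subspace_closure:
  fixes S :: "'a::real_normed_vector set"
  assumes "subspace S"
  shows "subspace (closure S)"
proof (rule subspaceI)
  show "0 \<in> closure S" using assms subspace_0 closure_subset by blast
  show "x + y \<in> closure S" if x: "x \<in> closure S" and y: "y \<in> closure S" for x y
  proof -
    obtain a where a: "\<And>n. a n \<in> S" "a \<longlonglongrightarrow> x" using x closure_sequential[of x S] by blast
    obtain b where b: "\<And>n. b n \<in> S" "b \<longlonglongrightarrow> y" using y closure_sequential[of y S] by blast
    have "(\<lambda>n. a n + b n) \<longlonglongrightarrow> x + y" by (intro tendsto_intros a b)
    moreover have "a n + b n \<in> S" for n using a b assms by (simp add: subspace_add)
    ultimately show ?thesis unfolding closure_sequential
      by (intro exI[of _ "\<lambda>n. a n + b n"]) simp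
  qed
  show "c *\<^sub>R x \<in> closure S" if x: "x \<in> closure S" for c x
  proof -
    obtain a where a: "\<And>n. a n \<in> S" "a \<longlonglongrightarrow> x" using x closure_sequential[of x S] by blast
    have "(\<lambda>n. c *\<^sub>R a n) \<longlonglongrightarrow> c *\<^sub>R x" by (intro tendsto_intros a)
    moreover have "c *\<^sub>R a n \<in> S" for n using a assms by (simp add: subspace_scale)
    ultimately show ?thesis unfolding closure_sequential
      by (intro exI[of _ "\<lambda>n. c *\<^sub>R a n"]) simp
  qed
qed

lemma inner_closure_range_eq_0:
  fixes P :: "'a \<Rightarrow> 'b::real_inner"
  assumes "d \<in> closure (range P)" and "\<And>z. inner (P z) x = 0"
  shows "inner d x = 0"
proof -
  obtain s where s: "\<And>n. s n \<in> range P" "s \<longlonglongrightarrow> d"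
    using assms(1) closure_sequential[of d "range P"] by blast
  have "(\<lambda>n. inner (s n) x) \<longlonglongrightarrow> inner d x" by (intro tendsto_intros s)
  moreover have "inner (s n) x = 0" for n using s(1)[of n] assms(2) by auto
  ultimately show ?thesis by (simp add: LIMSEQ_const_iff)
qed

text \<open>This is the uniqueness half of the representation: two representing vectors in the
  closure of the range differ by such a \<open>d\<close>.\<close>

lemma orthogonal_in_closure_range_eq_0:
  fixes P :: "'a \<Rightarrow> 'b::real_inner"
  assumes "d \<in> closure (range P)" and "\<And>z. inner (P z) d = 0"
  shows "d = 0"
  using inner_closure_range_eq_0[OF assms] by simp

text \<open>\<open>V\<close> is the adjoint of the factor \<open>U\<close> sought in
  \<open>T = U P\<close>. Its value at \<open>y\<close> represents the functional
  \<open>inner (T x) y\<close>; linearity follows because representatives inside the closure of the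
  range are unique. Taking \<open>P\<close> to be the identity yields adjoints.\<close>

lemma blinfun_factor:
  fixes T P :: "'a::real_inner \<Rightarrow>\<^sub>L 'b::{real_inner,banach}"
  assumes K: "\<And>x. norm (T x) \<le> K * norm (P x)" "0 \<le> K"
  obtains V :: "'b \<Rightarrow>\<^sub>L 'b" where "\<And>x y. inner (T x) y = inner (P x) (V y)"
    "\<And>y. V y \<in> closure (range P)" "norm V \<le> K"
proof -
  have linP: "linear (blinfun_apply P)" by (rule blinfun.bounded_linear_right[THEN bounded_linear.linear])
  have "\<exists>u. u \<in> closure (range P) \<and> (\<forall>x. inner (T x) y = inner (P x) u) \<and> norm u \<le> K * norm y" for y
  proof (rule riesz_on_range[OF linP, of "\<lambda>x. inner (T x) y" "K * norm y"])
    show "linear (\<lambda>x. inner (T x) y)"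
      by (intro linearI) (simp_all add: blinfun.add_right blinfun.scaleR_right inner_add_left)
    show "\<bar>inner (T w) y\<bar> \<le> K * norm y * norm (P w)" for w
    proof -
      have "\<bar>inner (T w) y\<bar> \<le> norm (T w) * norm y" by (rule Cauchy_Schwarz_ineq2)
      also have "\<dots> \<le> (K * norm (P w)) * norm y" by (intro mult_right_mono K) simp
      finally show ?thesis by (simp add: mult_ac)
    qed
    fix u assume "u \<in> closure (range P)" "\<And>w. inner (T w) y = inner (P w) u"
      "norm u \<le> K * norm y \<or> K * norm y < 0"
    moreover have "0 \<le> K * norm y" using K(2) by simp
    ultimately show ?thesis by (intro exI[of _ u]) auto
  qed
  then obtain v where v: "\<And>y. v y \<in> closure (range P)" "\<And>x y. inner (T x) y = inner (P x) (v y)"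
    "\<And>y. norm (v y) \<le> K * norm y" by metis
  have sub: "subspace (closure (range P))"
    by (intro subspace_closure linear_subspace_image linP subspace_UNIV)
  have "bounded_linear v"
  proof (rule bounded_linear_intro[of _ K])
    fix x y :: 'b and r :: real
    have "v (x + y) - (v x + v y) = 0"
    proof (rule orthogonal_in_closure_range_eq_0)
      show "v (x + y) - (v x + v y) \<in> closure (range P)"
        using sub v(1) by (intro subspace_diff subspace_add)
      show "inner (P z) (v (x + y) - (v x + v y)) = 0" for z
        by (simp add: inner_diff_right inner_add_right flip: v(2))
    qed
    then show "v (x + y) = v x + v y" by simp
    have "v (r *\<^sub>R x) - r *\<^sub>R v x = 0"
    proof (rule orthogonal_in_closure_range_eq_0)
      show "v (r *\<^sub>R x) - r *\<^sub>R v x \<in> closure (range P)"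
        using sub v(1) by (intro subspace_diff subspace_scale)
      show "inner (P z) (v (r *\<^sub>R x) - r *\<^sub>R v x) = 0" for z
        by (simp add: inner_diff_right flip: v(2))
    qed
    then show "v (r *\<^sub>R x) = r *\<^sub>R v x" by simp
    show "norm (v x) \<le> norm x * K" using v(3)[of x] by (simp add: mult.commute)
  qed
  then have app: "blinfun_apply (Blinfun v) = v" by (rule bounded_linear_Blinfun_apply)
  show ?thesis
    by (rule that[of "Blinfun v"]) (use v K(2) in \<open>auto simp: app intro!: norm_blinfun_bound\<close>)
qed

lemma norm_le_of_adjoint:
  fixes T S :: "'a::real_inner \<Rightarrow>\<^sub>L 'a"
  assumes "\<And>x y. inner (T x) y = inner x (S y)"
  shows "norm S \<le> norm T"
proof (rule norm_blinfun_bound)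
  fix y
  have "norm (S y) * norm (S y) = inner (T (S y)) y"
    by (simp add: assms power2_norm_eq_inner[symmetric] power2_eq_square)
  also have "\<dots> \<le> norm (T (S y)) * norm y" by (rule norm_cauchy_schwarz)
  also have "\<dots> \<le> (norm T * norm (S y)) * norm y"
    by (intro mult_right_mono norm_blinfun) simp
  finally show "norm (S y) \<le> norm T * norm y"
    by (cases "S y = 0") (auto simp: mult_ac)
qed simp

lemma real_adjoint_exists:
  fixes T :: "'a::{real_inner,banach} \<Rightarrow>\<^sub>L 'a"
  obtains S :: "'a \<Rightarrow>\<^sub>L 'a" where "\<And>x y. inner (T x) y = inner x (S y)"
  using blinfun_factor[of T "norm T" id_blinfun, OF _ norm_ge_zero] norm_blinfun[of T]
  by (metis id_blinfun.rep_eq)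

section \<open>Positive square roots\<close>

definition blinfun_selfadjoint :: "('a::real_inner \<Rightarrow>\<^sub>L 'a) \<Rightarrow> bool"
  where "blinfun_selfadjoint A \<longleftrightarrow> (\<forall>x y. inner (A x) y = inner x (A y))"

lemma blinfun_selfadjointD: "blinfun_selfadjoint A \<Longrightarrow> inner (A x) y = inner x (A y)"
  by (simp add: blinfun_selfadjoint_def)

text \<open>With \<open>m = norm D\<close>, a unit vector \<open>x\<close> that nearly attains the
  norm satisfies \<open>D (D x)\<close> close to \<open>m * m\<close> times \<open>x\<close>. Since
  \<open>D^2 - m^2\<close> factors as \<open>(D - m) (D + m)\<close>, the vectors
  \<open>D x + m x\<close> and \<open>D x - m x\<close> are candidates for the approximate
  eigenvalues \<open>m\<close> and \<open>-m\<close>, and at least one of them is not short.\<close>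

lemma approximate_eigenvector:
  fixes D :: "'a::real_inner \<Rightarrow>\<^sub>L 'a"
  assumes D: "blinfun_selfadjoint D" "D \<noteq> 0" and "0 < d"
  obtains v l where "v \<noteq> 0" "\<bar>l\<bar> = norm D" "norm (D v - l *\<^sub>R v) \<le> d * norm v"
proof -
  define m where "m = norm D"
  have m: "0 < m" using D by (simp add: m_def)
  \<comment> \<open>The squared defect of \<open>D (D x)\<close> will be at most
    \<open>m^2 * (4 * m * e)\<close>, which this choice puts below \<open>(d * m)^2\<close>;
    \<open>e\<close> at most \<open>m\<close> keeps \<open>m - e\<close> nonnegative for
    squaring.\<close>
  define e where "e = min m (d\<^sup>2 / (4 * m))"
  have e: "0 < e" "e \<le> m" "4 * m * e \<le> d\<^sup>2"
    using m \<open>0 < d\<close> by (auto simp: e_def min_def field_simps)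
  have "\<exists>x. (m - e) * norm x < norm (D x)"
  proof (rule ccontr)
    assume "\<not> ?thesis"
    then have "norm D \<le> m - e" using e by (intro norm_blinfun_bound) (auto simp: not_less)
    then show False using e by (simp add: m_def)
  qed
  then obtain x0 where x0: "(m - e) * norm x0 < norm (D x0)" by blast
  then have "x0 \<noteq> 0" by auto
  define x where "x = x0 /\<^sub>R norm x0"
  have nx: "norm x = 1" using \<open>x0 \<noteq> 0\<close> by (simp add: x_def)
  have Dx: "m - e \<le> norm (D x)"
    using x0 \<open>x0 \<noteq> 0\<close> by (simp add: x_def blinfun.scaleR_right field_simps)
  have DDx: "norm (D (D x)) \<le> m * m"
  proof -
    have "norm (D (D x)) \<le> m * norm (D x)" unfolding m_def by (rule norm_blinfun)
    also have "\<dots> \<le> m * (m * norm x)" unfolding m_def by (intro mult_left_mono norm_blinfun) simp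
    finally show ?thesis by (simp add: nx)
  qed
  have "(norm (D (D x) - (m * m) *\<^sub>R x))\<^sup>2
      = (norm (D (D x)))\<^sup>2 - 2 * (m * m) * inner (D (D x)) x + (m * m)\<^sup>2 * (norm x)\<^sup>2"
    unfolding power2_norm_eq_inner
    by (simp add: inner_diff inner_commute power2_eq_square algebra_simps)
  also have "inner (D (D x)) x = (norm (D x))\<^sup>2"
    using D(1) by (simp add: blinfun_selfadjointD power2_norm_eq_inner)
  also have "(norm (D (D x)))\<^sup>2 - 2 * (m * m) * (norm (D x))\<^sup>2 + (m * m)\<^sup>2 * (norm x)\<^sup>2
      \<le> (m * m)\<^sup>2 - 2 * (m * m) * (m - e)\<^sup>2 + (m * m)\<^sup>2 * 1"
    using DDx Dx e(2) nx
    by (intro add_mono diff_mono mult_left_mono power_mono) auto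
  also have "\<dots> = m\<^sup>2 * (4 * m * e) - 2 * (m * e)\<^sup>2"
    by (simp add: power2_eq_square algebra_simps)
  also have "\<dots> \<le> m\<^sup>2 * (4 * m * e)" by simp
  also have "\<dots> \<le> m\<^sup>2 * d\<^sup>2" using e(3) by (intro mult_left_mono) auto
  finally have "(norm (D (D x) - (m * m) *\<^sub>R x))\<^sup>2 \<le> (d * m)\<^sup>2"
    by (simp add: power_mult_distrib mult.commute)
  then have sm: "norm (D (D x) - (m * m) *\<^sub>R x) \<le> d * m"
    by (rule power2_le_imp_le) (use m \<open>0 < d\<close> in simp)
  note witness = that
  have cand: "thesis" if l: "\<bar>l\<bar> = m" and big: "m \<le> norm (D x + l *\<^sub>R x)" for l
  proof (rule witness)
    show "D x + l *\<^sub>R x \<noteq> 0" using m big by auto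
    show "\<bar>l\<bar> = norm D" using l by (simp add: m_def)
    have ll: "l * l = m * m" using l by (metis abs_mult_self_eq)
    have "D (D x + l *\<^sub>R x) - l *\<^sub>R (D x + l *\<^sub>R x) = D (D x) - (m * m) *\<^sub>R x"
      by (simp add: blinfun.add_right blinfun.scaleR_right algebra_simps ll)
    then have "norm (D (D x + l *\<^sub>R x) - l *\<^sub>R (D x + l *\<^sub>R x)) \<le> d * m"
      using sm by simp
    also have "\<dots> \<le> d * norm (D x + l *\<^sub>R x)" using big \<open>0 < d\<close> by simp
    finally show "norm (D (D x + l *\<^sub>R x) - l *\<^sub>R (D x + l *\<^sub>R x)) \<le> d * norm (D x + l *\<^sub>R x)" .
  qed
  \<comment> \<open>The two candidates differ by \<open>2 * m\<close> times a unit vector, so one of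
    them has norm at least \<open>m\<close>.\<close>
  have "2 * m = norm ((D x + m *\<^sub>R x) - (D x + (- m) *\<^sub>R x))"
    using m nx by (simp flip: scaleR_left_distrib)
  also have "\<dots> \<le> norm (D x + m *\<^sub>R x) + norm (D x + (- m) *\<^sub>R x)" by (rule norm_triangle_ineq4)
  finally have "m \<le> norm (D x + m *\<^sub>R x) \<or> m \<le> norm (D x + (- m) *\<^sub>R x)" by linarith
  then show ?thesis using cand[of m] cand[of "- m"] m by auto
qed

text \<open>Put \<open>D = R - S\<close>, \<open>Q = R + S\<close>, \<open>m = norm D\<close>, and
  let \<open>e\<close> be the right-hand side. By symmetry the cross terms cancel in
  \<open>inner (D x) (Q x)\<close>, leaving the quadratic form of the difference of squares. On an
  approximate eigenvector \<open>v\<close> of \<open>D\<close>, up to small errors,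
  \<open>m * (norm v)^2\<close> is at most \<open>inner (Q v) v\<close>, and
  \<open>m * inner (Q v) v\<close> is at most \<open>e * (norm v)^2\<close>; multiplying out gives
  \<open>m^2\<close> at most \<open>e\<close>. The estimate yields both uniqueness and continuity of
  positive roots, without \<open>R\<close> and \<open>S\<close> commuting.\<close>

lemma norm_diff_power2_le_norm_squares_diff:
  fixes R S :: "'a::real_inner \<Rightarrow>\<^sub>L 'a"
  assumes R: "blinfun_selfadjoint R" "\<And>x. 0 \<le> inner (R x) x"
    and S: "blinfun_selfadjoint S" "\<And>x. 0 \<le> inner (S x) x"
  shows "(norm (R - S))\<^sup>2 \<le> norm ((R o\<^sub>L R) - (S o\<^sub>L S))"
proof (cases "R = S")
  case False
  define D where "D = R - S"
  define Q where "Q = R + S"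
  define e where "e = norm ((R o\<^sub>L R) - (S o\<^sub>L S))"
  define m where "m = norm D"
  have D: "blinfun_selfadjoint D" "D \<noteq> 0"
    using R S False by (auto simp: D_def blinfun_selfadjoint_def blinfun.diff_left inner_diff)
  have form: "\<bar>inner (D x) (Q x)\<bar> \<le> e * (norm x)\<^sup>2" for x
  proof -
    have "inner (D x) (Q x) = inner (((R o\<^sub>L R) - (S o\<^sub>L S)) x) x"
      by (simp add: D_def Q_def blinfun.diff_left blinfun.add_left inner_diff_left inner_add_left
          inner_add_right blinfun_selfadjointD[OF R(1), of "R x" x]
          blinfun_selfadjointD[OF S(1), of "S x" x] inner_commute[of "S x" "R x"])
    also have "\<bar>\<dots>\<bar> \<le> norm (((R o\<^sub>L R) - (S o\<^sub>L S)) x) * norm x" by (rule Cauchy_Schwarz_ineq2)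
    also have "\<dots> \<le> (e * norm x) * norm x" unfolding e_def
      by (intro mult_right_mono norm_blinfun) simp
    finally show ?thesis by (simp add: power2_eq_square mult_ac)
  qed
  \<comment> \<open>Positivity of both operators places \<open>R - S\<close> between
    \<open>-(R + S)\<close> and \<open>R + S\<close>.\<close>
  have DQ: "\<bar>inner (D x) x\<bar> \<le> inner (Q x) x" for x
    using R(2)[of x] S(2)[of x] by (simp add: D_def Q_def blinfun.diff_left blinfun.add_left inner_diff inner_add)
  have "m\<^sup>2 \<le> e + d * (m + norm Q)" if d: "0 < d" for d
  proof -
    obtain v l where v: "v \<noteq> 0" "\<bar>l\<bar> = m" "norm (D v - l *\<^sub>R v) \<le> d * norm v"
      using approximate_eigenvector[OF D d] unfolding m_def by metis
    define r where "r = D v - l *\<^sub>R v"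
    have Dv: "D v = l *\<^sub>R v + r" by (simp add: r_def)
    have nr: "norm r \<le> d * norm v" using v by (simp add: r_def)
    have rz: "\<bar>inner r z\<bar> \<le> d * norm v * norm z" for z
      using Cauchy_Schwarz_ineq2[of r z] mult_right_mono[OF nr norm_ge_zero[of z]] by linarith
    have "m * (norm v)\<^sup>2 = \<bar>inner (D v) v - inner r v\<bar>"
      using v(2) by (simp add: Dv inner_add power2_norm_eq_inner abs_mult)
    also have "\<dots> \<le> inner (Q v) v + d * norm v * norm v" using DQ[of v] rz[of v] by linarith
    finally have 1: "m * (norm v)\<^sup>2 \<le> inner (Q v) v + d * (norm v)\<^sup>2" by (simp add: power2_eq_square mult_ac)
    have "m * inner (Q v) v = \<bar>inner (D v) (Q v) - inner r (Q v)\<bar>"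
      using v(2) DQ[of v] by (simp add: Dv inner_add abs_mult inner_commute)
    also have "\<dots> \<le> e * (norm v)\<^sup>2 + d * norm v * norm (Q v)" using form[of v] rz[of "Q v"] by linarith
    also have "d * norm v * norm (Q v) \<le> d * norm v * (norm Q * norm v)"
      using d by (intro mult_left_mono norm_blinfun) auto
    finally have 2: "m * inner (Q v) v \<le> (e + d * norm Q) * (norm v)\<^sup>2"
      by (simp add: power2_eq_square algebra_simps)
    have "m\<^sup>2 * (norm v)\<^sup>2 = m * (m * (norm v)\<^sup>2)" by (simp add: power2_eq_square)
    also have "\<dots> \<le> m * (inner (Q v) v + d * (norm v)\<^sup>2)" using 1 by (intro mult_left_mono) (auto simp: m_def)
    also have "\<dots> \<le> (e + d * (m + norm Q)) * (norm v)\<^sup>2" using 2 by (simp add: algebra_simps)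
    finally show ?thesis using v(1) by simp
  qed
  note bound = this
  \<comment> \<open>The error is linear in the eigenvector tolerance \<open>d\<close>, which now
    tends to 0.\<close>
  have "m\<^sup>2 \<le> e"
  proof (rule field_le_epsilon)
    fix c :: real assume c: "0 < c"
    define s where "s = m + norm Q + 1"
    have s: "0 < s" by (simp add: s_def m_def add_nonneg_pos)
    have "m\<^sup>2 \<le> e + (c / s) * (m + norm Q)" using bound[of "c / s"] c s by simp
    also have "(c / s) * (m + norm Q) \<le> (c / s) * s" using c s by (intro mult_left_mono) (auto simp: s_def)
    also have "\<dots> = c" using s by simp
    finally show "m\<^sup>2 \<le> e + c" by simp
  qed
  then show ?thesis by (simp add: m_def e_def D_def)
qed simp

section \<open>Existence of positive square roots by a fixed-point iteration\<close>

interpretation blinfun_compose: bounded_bilinear "(o\<^sub>L)"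
  by (rule bounded_bilinear_blinfun_compose)

text \<open>For \<open>C = 1 - A\<close>, the operator \<open>1 - Y\<close> squares to
  \<open>A\<close> exactly when \<open>Y = (C + Y^2) / 2\<close>; this is the fixed-point iteration
  for that equation, started at 0.\<close>

primrec sqrt_iter :: "('a::real_normed_vector \<Rightarrow>\<^sub>L 'a) \<Rightarrow> nat \<Rightarrow> 'a \<Rightarrow>\<^sub>L 'a" where
  "sqrt_iter C 0 = 0"
| "sqrt_iter C (Suc n) = (1/2) *\<^sub>R (C + (sqrt_iter C n o\<^sub>L sqrt_iter C n))"

text \<open>The same recursion with \<open>C\<close> replaced by the number 1, the largest value
  that \<open>norm C\<close> may take.\<close>

primrec scalar_iter :: "nat \<Rightarrow> real" where
  "scalar_iter 0 = 0"
| "scalar_iter (Suc n) = (1 + (scalar_iter n)\<^sup>2) / 2"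

lemma scalar_iter_bounds: "0 \<le> scalar_iter n" "scalar_iter n \<le> 1"
proof -
  have "0 \<le> scalar_iter n \<and> scalar_iter n \<le> 1"
    by (induction n) (auto simp: power_le_one)
  then show "0 \<le> scalar_iter n" "scalar_iter n \<le> 1" by auto
qed

lemma scalar_iter_Suc_ge: "scalar_iter n \<le> scalar_iter (Suc n)"
proof -
  have "0 \<le> (1 - scalar_iter n)\<^sup>2" by simp
  then show ?thesis by (simp add: power2_eq_square algebra_simps)
qed

lemma scalar_iter_mono: "m \<le> n \<Longrightarrow> scalar_iter m \<le> scalar_iter n"
  by (rule lift_Suc_mono_le[of scalar_iter]) (rule scalar_iter_Suc_ge)

lemma norm_sqrt_iter_le:
  assumes "norm C \<le> 1"
  shows "norm (sqrt_iter C n) \<le> scalar_iter n"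
proof (induction n)
  case (Suc n)
  have "norm (sqrt_iter C n o\<^sub>L sqrt_iter C n) \<le> norm (sqrt_iter C n) * norm (sqrt_iter C n)"
    by (rule norm_blinfun_compose)
  also have "\<dots> \<le> scalar_iter n * scalar_iter n"
    by (intro mult_mono Suc.IH) (auto simp: scalar_iter_bounds)
  finally have "norm (C + (sqrt_iter C n o\<^sub>L sqrt_iter C n)) \<le> 1 + (scalar_iter n)\<^sup>2"
    using assms by (intro norm_triangle_le) (simp add: power2_eq_square)
  then show ?case by simp
qed simp

text \<open>The operator iteration is dominated by the scalar one, which is what makes it converge in
  norm and not only strongly.\<close>

lemma norm_sqrt_iter_step_le:
  assumes C: "norm C \<le> 1"
  shows "norm (sqrt_iter C (Suc n) - sqrt_iter C n) \<le> scalar_iter (Suc n) - scalar_iter n"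
proof (induction n)
  case 0
  show ?case using C by simp
next
  case (Suc n)
  let ?Y = "sqrt_iter C" and ?y = "scalar_iter"
  let ?D = "?Y (Suc n) - ?Y n"
  \<comment> \<open>A difference of squares in noncommutative form; the scalar bound obtained from
    it collapses to half the difference of consecutive squares.\<close>
  have "?Y (Suc (Suc n)) - ?Y (Suc n) = (1/2) *\<^sub>R ((?Y (Suc n) o\<^sub>L ?D) + (?D o\<^sub>L ?Y n))"
  proof -
    have "?Y (Suc (Suc n)) - ?Y (Suc n)
        = (1/2) *\<^sub>R (C + (?Y (Suc n) o\<^sub>L ?Y (Suc n))) - (1/2) *\<^sub>R (C + (?Y n o\<^sub>L ?Y n))"
      by (simp only: sqrt_iter.simps)
    also have "\<dots> = (1/2) *\<^sub>R ((?Y (Suc n) o\<^sub>L ?D) + (?D o\<^sub>L ?Y n))"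
      by (simp only: blinfun_compose.diff_left blinfun_compose.diff_right scaleR_diff_right[symmetric]) simp
    finally show ?thesis .
  qed
  also have "norm \<dots> \<le> (1/2) * (norm (?Y (Suc n)) * norm ?D + norm ?D * norm (?Y n))"
    unfolding norm_scaleR
    by (intro mult_mono norm_triangle_mono norm_blinfun_compose) auto
  also have "\<dots> \<le> (1/2) * (?y (Suc n) * (?y (Suc n) - ?y n) + (?y (Suc n) - ?y n) * ?y n)"
    using norm_sqrt_iter_le[OF C] scalar_iter_bounds scalar_iter_Suc_ge[of n]
    by (intro mult_left_mono add_mono mult_mono Suc.IH) (auto simp del: sqrt_iter.simps scalar_iter.simps)
  also have "\<dots> = (?y (Suc n) * ?y (Suc n) - ?y n * ?y n) / 2"
    by (simp add: algebra_simps del: scalar_iter.simps)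
  also have "\<dots> = ?y (Suc (Suc n)) - ?y (Suc n)"
    unfolding scalar_iter.simps(2)[of "Suc n"] scalar_iter.simps(2)[of n]
    by (simp add: power2_eq_square field_simps del: scalar_iter.simps)
  finally show ?case .
qed

lemma norm_sqrt_iter_diff_le:
  assumes "norm C \<le> 1" "m \<le> n"
  shows "norm (sqrt_iter C n - sqrt_iter C m) \<le> scalar_iter n - scalar_iter m"
  using assms(2)
proof (induction n rule: dec_induct)
  case (step n)
  have "norm (sqrt_iter C (Suc n) - sqrt_iter C m)
      \<le> norm (sqrt_iter C (Suc n) - sqrt_iter C n) + norm (sqrt_iter C n - sqrt_iter C m)"
    using norm_triangle_ineq[of "sqrt_iter C (Suc n) - sqrt_iter C n" "sqrt_iter C n - sqrt_iter C m"]
    by (simp del: sqrt_iter.simps)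
  then show ?case using norm_sqrt_iter_step_le[OF assms(1), of n] step.IH by linarith
qed simp

text \<open>The scalar majorant is increasing and bounded, hence Cauchy, and its increments dominate
  those of the operator iteration.\<close>

lemma sqrt_iter_convergent:
  fixes C :: "'a::banach \<Rightarrow>\<^sub>L 'a"
  assumes C: "norm C \<le> 1"
  obtains Y where "sqrt_iter C \<longlonglongrightarrow> Y"
proof -
  have "incseq scalar_iter" by (simp add: incseq_def scalar_iter_mono)
  then obtain l where "scalar_iter \<longlonglongrightarrow> l"
    using incseq_convergent[of scalar_iter 1] scalar_iter_bounds(2) by blast
  then have cau: "Cauchy scalar_iter" by (rule LIMSEQ_imp_Cauchy)
  have "Cauchy (sqrt_iter C)"
  proof (rule metric_CauchyI)
    fix e :: real assume "0 < e"
    then obtain N where N: "\<forall>m\<ge>N. \<forall>n\<ge>N. dist (scalar_iter m) (scalar_iter n) < e"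
      using metric_CauchyD[OF cau] by blast
    have *: "dist (sqrt_iter C n) (sqrt_iter C m) < e" if "N \<le> m" "m \<le> n" for m n
    proof -
      have "dist (scalar_iter n) (scalar_iter m) < e" using N that by simp
      then show ?thesis using norm_sqrt_iter_diff_le[OF C that(2)] by (simp add: dist_norm)
    qed
    have "dist (sqrt_iter C m) (sqrt_iter C n) < e" if "N \<le> m" "N \<le> n" for m n
    proof (cases "m \<le> n")
      case True
      then show ?thesis using *[of m n] that by (simp add: dist_commute)
    next
      case False
      then show ?thesis using *[of n m] that by simp
    qed
    then show "\<exists>M. \<forall>m\<ge>M. \<forall>n\<ge>M. dist (sqrt_iter C m) (sqrt_iter C n) < e" by blast
  qed
  then show ?thesis using that Cauchy_convergent_iff convergent_def by blast
qed

text \<open>Expanding positivity of \<open>A\<close> at \<open>x - A x\<close> and using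
  \<open>norm A\<close> at most 1 gives \<open>(norm (A x))^2\<close> at most
  \<open>inner (A x) x\<close>; hence subtracting \<open>A x\<close> from \<open>x\<close> cannot
  increase its norm.\<close>

lemma norm_id_minus_positive_le_1:
  fixes A :: "'a::real_inner \<Rightarrow>\<^sub>L 'a"
  assumes A: "blinfun_selfadjoint A" "\<And>x. 0 \<le> inner (A x) x" "norm A \<le> 1"
  shows "norm (id_blinfun - A) \<le> 1"
proof (rule norm_blinfun_bound)
  fix x
  have "inner (A (A x)) (A x) \<le> norm (A (A x)) * norm (A x)" by (rule norm_cauchy_schwarz)
  also have "norm (A (A x)) \<le> 1 * norm (A x)"
    using norm_blinfun[of A "A x"] mult_right_mono[OF A(3) norm_ge_zero[of "A x"]] by linarith
  finally have "inner (A (A x)) (A x) \<le> inner (A x) (A x)"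
    by (simp add: mult_right_mono dot_square_norm power2_eq_square)
  moreover have "0 \<le> inner (A (x - A x)) (x - A x)" by (rule A(2))
  moreover have "inner (A (A x)) x = inner (A x) (A x)"
    by (rule blinfun_selfadjointD[OF A(1)])
  ultimately have "inner (A x) (A x) \<le> inner (A x) x"
    by (simp add: blinfun.diff_right inner_diff)
  then have "(norm (x - A x))\<^sup>2 \<le> (norm x)\<^sup>2"
    using A(2)[of x] by (simp add: power2_norm_eq_inner inner_diff inner_commute)
  then show "norm ((id_blinfun - A) x) \<le> 1 * norm x"
    by (simp add: blinfun.diff_left)
qed simp

text \<open>The root is \<open>1 - Y\<close> for the limit \<open>Y\<close> of the iteration, and it
  is positive because \<open>norm Y\<close> is at most 1. Every iterate commutes with whatever
  commutes with \<open>A\<close>, and this passes to the limit; the clause later supplies complex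
  linearity of the root.\<close>

lemma positive_sqrt_exists_contraction:
  fixes A :: "'a::{real_inner,banach} \<Rightarrow>\<^sub>L 'a"
  assumes A: "blinfun_selfadjoint A" "\<And>x. 0 \<le> inner (A x) x" "norm A \<le> 1"
  obtains R where "blinfun_selfadjoint R" "\<And>x. 0 \<le> inner (R x) x" "(R o\<^sub>L R) = A"
    "\<And>B. (A o\<^sub>L B) = (B o\<^sub>L A) \<Longrightarrow> (R o\<^sub>L B) = (B o\<^sub>L R)"
proof -
  define C where "C = id_blinfun - A"
  have C: "norm C \<le> 1" unfolding C_def by (rule norm_id_minus_positive_le_1[OF A])
  obtain Y where Y: "sqrt_iter C \<longlonglongrightarrow> Y" using sqrt_iter_convergent[OF C] by blast
  have fixY: "Y = (1/2) *\<^sub>R (C + (Y o\<^sub>L Y))"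
  proof (rule LIMSEQ_unique)
    show "(\<lambda>n. sqrt_iter C (Suc n)) \<longlonglongrightarrow> Y" using Y by (rule LIMSEQ_Suc)
    show "(\<lambda>n. sqrt_iter C (Suc n)) \<longlonglongrightarrow> (1/2) *\<^sub>R (C + (Y o\<^sub>L Y))"
      unfolding sqrt_iter.simps by (intro tendsto_intros blinfun_compose.tendsto Y)
  qed
  have nY: "norm Y \<le> 1"
  proof (rule LIMSEQ_le_const2)
    show "(\<lambda>n. norm (sqrt_iter C n)) \<longlonglongrightarrow> norm Y" by (intro tendsto_norm Y)
    show "\<exists>N. \<forall>n\<ge>N. norm (sqrt_iter C n) \<le> 1"
      using norm_sqrt_iter_le[OF C] scalar_iter_bounds(2) order_trans by blast
  qed
  have Yx: "(\<lambda>n. sqrt_iter C n x) \<longlonglongrightarrow> Y x" for x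
    by (intro blinfun.tendsto Y tendsto_const)
  have "blinfun_selfadjoint (sqrt_iter C n)" for n
    by (induction n) (use A(1) in \<open>auto simp: blinfun_selfadjoint_def C_def blinfun.diff_left
        blinfun.add_left blinfun.scaleR_left inner_diff inner_add\<close>)
  then have "inner (sqrt_iter C n x) y = inner x (sqrt_iter C n y)" for n x y
    by (simp add: blinfun_selfadjointD)
  then have saY: "inner (Y x) y = inner x (Y y)" for x y
    using tendsto_inner[OF Yx[of x] tendsto_const[of y]] tendsto_inner[OF tendsto_const[of x] Yx[of y]]
    by (simp add: LIMSEQ_unique)
  define R where "R = id_blinfun - Y"
  show ?thesis
  proof (rule that)
    show "blinfun_selfadjoint R"
      by (simp add: blinfun_selfadjoint_def R_def blinfun.diff_left inner_diff saY)
    show "0 \<le> inner (R x) x" for x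
    proof -
      have "inner (Y x) x \<le> norm (Y x) * norm x" by (rule norm_cauchy_schwarz)
      also have "\<dots> \<le> (norm Y * norm x) * norm x" by (intro mult_right_mono norm_blinfun) simp
      also have "\<dots> \<le> (1 * norm x) * norm x" by (intro mult_right_mono nY) auto
      finally show ?thesis
        by (simp add: R_def blinfun.diff_left inner_diff dot_square_norm power2_eq_square)
    qed
    have YY: "(Y o\<^sub>L Y) = 2 *\<^sub>R Y - C"
      using arg_cong[OF fixY, of "\<lambda>Z. 2 *\<^sub>R Z - C"] by simp
    show "(R o\<^sub>L R) = A"
    proof (rule blinfun_eqI)
      fix x
      have "Y (Y x) = 2 *\<^sub>R Y x - (x - A x)"
        using arg_cong[OF YY, of "\<lambda>Z. Z x"]
        by (simp add: C_def blinfun.diff_left blinfun.scaleR_left)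
      then show "(R o\<^sub>L R) x = A x"
        by (simp add: R_def blinfun.diff_left blinfun.diff_right scaleR_2)
    qed
    fix B assume AB: "(A o\<^sub>L B) = (B o\<^sub>L A)"
    have CB: "C (B x) = B (C x)" for x
      using arg_cong[OF AB, of "\<lambda>Z. Z x"] by (simp add: C_def blinfun.diff_left blinfun.diff_right)
    have YB: "sqrt_iter C n (B x) = B (sqrt_iter C n x)" for n x
      by (induction n arbitrary: x)
        (simp_all add: CB blinfun.add_left blinfun.scaleR_left blinfun.add_right blinfun.scaleR_right)
    have "Y (B x) = B (Y x)" for x
    proof (rule LIMSEQ_unique[OF Yx])
      show "(\<lambda>n. sqrt_iter C n (B x)) \<longlonglongrightarrow> B (Y x)"
        unfolding YB by (intro blinfun.tendsto tendsto_const Yx)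
    qed
    then show "(R o\<^sub>L B) = (B o\<^sub>L R)"
      by (intro blinfun_eqI) (simp add: R_def blinfun.diff_left blinfun.diff_right)
  qed
qed

lemma positive_sqrt_exists:
  fixes A :: "'a::{real_inner,banach} \<Rightarrow>\<^sub>L 'a"
  assumes A: "blinfun_selfadjoint A" "\<And>x. 0 \<le> inner (A x) x"
  obtains R where "blinfun_selfadjoint R" "\<And>x. 0 \<le> inner (R x) x" "(R o\<^sub>L R) = A"
    "\<And>B. (A o\<^sub>L B) = (B o\<^sub>L A) \<Longrightarrow> (R o\<^sub>L B) = (B o\<^sub>L R)"
proof (cases "A = 0")
  case True
  show ?thesis
    by (rule that[of 0])
      (simp_all add: True blinfun_selfadjoint_def blinfun_compose.zero_left blinfun_compose.zero_right)
next
  case False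
  define k where "k = norm A"
  have k: "0 < k" using False by (simp add: k_def)
  define A' where "A' = (1 / k) *\<^sub>R A"
  have "blinfun_selfadjoint A'" "\<And>x. 0 \<le> inner (A' x) x" "norm A' \<le> 1"
    using A k by (auto simp: A'_def blinfun_selfadjoint_def blinfun.scaleR_left k_def)
  then obtain R where R: "blinfun_selfadjoint R" "\<And>x. 0 \<le> inner (R x) x" "(R o\<^sub>L R) = A'"
    "\<And>B. (A' o\<^sub>L B) = (B o\<^sub>L A') \<Longrightarrow> (R o\<^sub>L B) = (B o\<^sub>L R)"
    using positive_sqrt_exists_contraction[of A'] by metis
  show ?thesis
  proof (rule that[of "sqrt k *\<^sub>R R"])
    show "blinfun_selfadjoint (sqrt k *\<^sub>R R)"
      using R(1) by (simp add: blinfun_selfadjoint_def blinfun.scaleR_left)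
    show "0 \<le> inner ((sqrt k *\<^sub>R R) x) x" for x using R(2) k by (simp add: blinfun.scaleR_left)
    show "(sqrt k *\<^sub>R R o\<^sub>L sqrt k *\<^sub>R R) = A"
      using k R(3) by (simp add: blinfun_compose.scaleR_left blinfun_compose.scaleR_right A'_def)
    show "(sqrt k *\<^sub>R R o\<^sub>L B) = (B o\<^sub>L sqrt k *\<^sub>R R)" if "(A o\<^sub>L B) = (B o\<^sub>L A)" for B
      using that R(4)[of B]
      by (simp add: blinfun_compose.scaleR_left blinfun_compose.scaleR_right A'_def)
  qed
qed

section \<open>Complex Hilbert spaces\<close>

lemma cinner_scaleC_right: "cinner x (c *\<^sub>C y) = cnj c * cinner x (y::'a::complex_inner)"
  by (metis cinner_commute cinner_scaleC_left complex_cnj_mult complex_cnj_cnj)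

lemma inner_scaleC_right: "inner x (c *\<^sub>C y) = inner (cnj c *\<^sub>C x) (y::'a::complex_inner)"
  by (simp add: inner_Re_cinner cinner_scaleC_left cinner_scaleC_right)

lemma Im_cinner: "Im (cinner x y) = - inner (\<i> *\<^sub>C x) (y::'a::complex_inner)"
  by (simp add: inner_Re_cinner cinner_scaleC_left)

lemma norm_scaleC: "norm (c *\<^sub>C x) = cmod c * norm (x::'a::complex_inner)"
proof -
  have "(norm (c *\<^sub>C x))\<^sup>2 = inner ((cnj c * c) *\<^sub>C x) x"
    by (simp add: power2_norm_eq_inner inner_scaleC_right scaleC_scaleC)
  also have "cnj c * c = complex_of_real ((cmod c)\<^sup>2)"
    by (subst complex_norm_square) (simp add: mult.commute)
  finally have "(norm (c *\<^sub>C x))\<^sup>2 = (cmod c * norm x)\<^sup>2"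
    by (simp add: scaleR_scaleC[symmetric] power2_norm_eq_inner[symmetric] power_mult_distrib
        del: of_real_power)
  then show ?thesis by (simp add: power2_eq_iff_nonneg)
qed

lemma bounded_linear_scaleC: "bounded_linear (\<lambda>x::'a::complex_inner. c *\<^sub>C x)"
proof (rule bounded_linear_intro[of _ "cmod c"])
  show "c *\<^sub>C (r *\<^sub>R x) = r *\<^sub>R (c *\<^sub>C x)" for r and x :: 'a
    by (simp add: scaleR_scaleC scaleC_scaleC mult.commute)
qed (simp_all add: scaleC_add_right norm_scaleC mult.commute)

lemma clinear_opD: "clinear_op T \<Longrightarrow> T (c *\<^sub>C x) = c *\<^sub>C T x"
  by (simp add: clinear_op_def)

lemma clinear_op_add: "clinear_op S \<Longrightarrow> clinear_op T \<Longrightarrow> clinear_op (S + T)"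
  by (simp add: clinear_op_def blinfun.add_left scaleC_add_right)

lemma clinear_op_compose: "clinear_op S \<Longrightarrow> clinear_op T \<Longrightarrow> clinear_op (S o\<^sub>L T)"
  by (simp add: clinear_op_def)

text \<open>The imaginary part of \<open>cinner\<close> is a real inner product with the first
  argument multiplied by \<open>\<i>\<close>, a factor that passes through the complex-linear
  \<open>T\<close>. This reduces complex adjoints to the real theory above.\<close>

lemma cinner_adjoint_iff_inner:
  fixes T S :: "'a::complex_inner \<Rightarrow>\<^sub>L 'a"
  assumes "clinear_op T"
  shows "(\<forall>x y. cinner (T x) y = cinner x (S y)) \<longleftrightarrow> (\<forall>x y. inner (T x) y = inner x (S y))"
    (is "?C \<longleftrightarrow> ?I")
proof
  show "?C \<Longrightarrow> ?I" by (simp add: inner_Re_cinner)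
  assume I: ?I
  show ?C
  proof (intro allI complex_eqI)
    fix x y
    show "Re (cinner (T x) y) = Re (cinner x (S y))" using I by (simp add: inner_Re_cinner)
    show "Im (cinner (T x) y) = Im (cinner x (S y))"
      using I assms by (simp add: Im_cinner clinear_opD[symmetric])
  qed
qed

lemma adjoint_unique:
  fixes S S' :: "'a::real_inner \<Rightarrow>\<^sub>L 'a"
  assumes "\<And>x y. inner x (S y) = inner x (S' y)"
  shows "S = S'"
proof (rule blinfun_eqI)
  fix y
  have "inner (S y - S' y) (S y - S' y) = 0"
    using assms by (simp add: inner_diff_right)
  then show "S y = S' y" by simp
qed

lemma inner_op_adjoint:
  fixes T :: "'a::chilbert_space \<Rightarrow>\<^sub>L 'a"
  assumes T: "clinear_op T"
  shows "inner (T x) y = inner x (op_adjoint T y)"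
proof -
  obtain S :: "'a \<Rightarrow>\<^sub>L 'a" where S: "\<And>x y. inner (T x) y = inner x (S y)"
    using real_adjoint_exists by blast
  have "op_adjoint T = S"
    unfolding op_adjoint_def cinner_adjoint_iff_inner[OF T]
    by (rule the_equality) (use S in \<open>auto intro!: adjoint_unique\<close>)
  then show ?thesis using S by simp
qed

lemma clinear_op_of_adjoint:
  fixes T S :: "'a::complex_inner \<Rightarrow>\<^sub>L 'a"
  assumes T: "clinear_op T" and S: "\<And>x y. inner (T x) y = inner x (S y)"
  shows "clinear_op S"
  unfolding clinear_op_def
proof (intro allI)
  fix c y
  have "inner x (S (c *\<^sub>C y) - c *\<^sub>C S y) = 0" for x
  proof -
    have "inner x (c *\<^sub>C S y) = inner (T (cnj c *\<^sub>C x)) y"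
      by (simp add: inner_scaleC_right S)
    also have "\<dots> = inner x (S (c *\<^sub>C y))"
      by (simp add: T clinear_opD inner_scaleC_right flip: S)
    finally show ?thesis by (simp add: inner_diff_right)
  qed
  then show "S (c *\<^sub>C y) = c *\<^sub>C S y" by (metis inner_eq_zero_iff eq_iff_diff_eq_0)
qed

section \<open>Complex positive operators and continuity of their square roots\<close>

text \<open>Over the complex field a real quadratic form already forces self-adjointness, by
  polarization. The equivalence gives access to the results on real operators, where
  self-adjointness is a separate hypothesis.\<close>

lemma positive_op_iff:
  "positive_op A \<longleftrightarrow> clinear_op A \<and> blinfun_selfadjoint A \<and> (\<forall>x. 0 \<le> inner (A x) x)"
proof
  assume pos: "positive_op A"
  then have A: "clinear_op A" and re: "\<And>x. cinner (A x) x \<in> \<real>\<^sub>\<ge>\<^sub>0" by (auto simp: positive_op_def)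
  have form: "0 \<le> inner (A x) x" "inner (\<i> *\<^sub>C A x) x = 0" for x
    using re[of x] Im_cinner[of "A x" x]
    by (auto simp: inner_Re_cinner complex_nonneg_Reals_iff)
  \<comment> \<open>Polarize the vanishing imaginary part of the form; replacing \<open>x\<close> by
    \<open>\<i>\<close> times \<open>x\<close> then turns this skew identity into symmetry of
    \<open>A\<close>.\<close>
  have skew: "inner (\<i> *\<^sub>C A x) y + inner (\<i> *\<^sub>C A y) x = 0" for x y
    using form(2)[of "x + y"] form(2)[of x] form(2)[of y]
    by (simp add: blinfun.add_right scaleC_add_right inner_add)
  have "inner (A x) y = inner x (A y)" for x y
  proof -
    have "\<i> *\<^sub>C \<i> *\<^sub>C z = - z" for z :: 'a
      using scaleR_scaleC[of "-1" z] by (simp add: scaleC_scaleC)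
    then have "inner (A y) x = inner (A x) y"
      using skew[of "\<i> *\<^sub>C x" y]
      by (simp add: clinear_opD[OF A] inner_scaleC_right inner_commute[of "\<i> *\<^sub>C A y"])
        (simp add: scaleC_scaleC scaleR_scaleC[of 1, symmetric, simplified] flip: scaleR_scaleC)
    then show ?thesis by (simp add: inner_commute)
  qed
  then show "clinear_op A \<and> blinfun_selfadjoint A \<and> (\<forall>x. 0 \<le> inner (A x) x)"
    using A form by (simp add: blinfun_selfadjoint_def)
next
  assume A: "clinear_op A \<and> blinfun_selfadjoint A \<and> (\<forall>x. 0 \<le> inner (A x) x)"
  have "Im (cinner (A x) x) = 0" for x
  proof -
    have "cinner (A x) x = cinner x (A x)"
      using cinner_adjoint_iff_inner[of A A] A by (simp add: blinfun_selfadjoint_def)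
    then have "cnj (cinner (A x) x) = cinner (A x) x" by (metis cinner_commute)
    then show ?thesis by (metis Reals_cnj_iff complex_is_Real_iff)
  qed
  then show "positive_op A" using A
    by (simp add: positive_op_def complex_nonneg_Reals_iff inner_Re_cinner)
qed

lemma norm_positive_op_diff_le:
  assumes "positive_op R" "positive_op S"
  shows "(norm (R - S))\<^sup>2 \<le> norm ((R o\<^sub>L R) - (S o\<^sub>L S))"
  using assms by (intro norm_diff_power2_le_norm_squares_diff) (auto simp: positive_op_iff)

text \<open>Two positive operators with equal squares coincide by
  \<open>norm_positive_op_diff_le\<close>, so the description in \<open>op_sqrt\<close> denotes the
  root constructed above.\<close>

lemma op_sqrt:
  assumes A: "positive_op A"
  shows "positive_op (op_sqrt A)" "(op_sqrt A o\<^sub>L op_sqrt A) = A"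
proof -
  obtain R where R: "blinfun_selfadjoint R" "\<And>x. 0 \<le> inner (R x) x" "(R o\<^sub>L R) = A"
    "\<And>B. (A o\<^sub>L B) = (B o\<^sub>L A) \<Longrightarrow> (R o\<^sub>L B) = (B o\<^sub>L R)"
    using positive_sqrt_exists[of A] A unfolding positive_op_iff by metis
  \<comment> \<open>Multiplication by \<open>c\<close> is a bounded real operator that commutes with
    \<open>A\<close>, hence with \<open>R\<close>.\<close>
  have "R (c *\<^sub>C x) = c *\<^sub>C R x" for c x
  proof -
    have [simp]: "blinfun_apply (Blinfun (\<lambda>x. c *\<^sub>C x)) = (\<lambda>x::'a. c *\<^sub>C x)"
      by (rule bounded_linear_Blinfun_apply[OF bounded_linear_scaleC])
    have "(A o\<^sub>L Blinfun (\<lambda>x. c *\<^sub>C x)) = (Blinfun (\<lambda>x. c *\<^sub>C x) o\<^sub>L A)"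
      using A by (intro blinfun_eqI) (simp add: positive_op_def clinear_opD)
    from arg_cong[OF R(4)[OF this], of "\<lambda>Z. Z x"] show ?thesis by simp
  qed
  then have R': "positive_op R \<and> (R o\<^sub>L R) = A" using R(1-3) by (simp add: positive_op_iff clinear_op_def)
  have "S = R" if "positive_op S \<and> (S o\<^sub>L S) = A" for S
    using norm_positive_op_diff_le[of S R] that R' by simp
  then have "op_sqrt A = R"
    unfolding op_sqrt_def using R' by (intro the_equality) blast+
  with R' show "positive_op (op_sqrt A)" "(op_sqrt A o\<^sub>L op_sqrt A) = A" by auto
qed

lemma tendsto_op_sqrt:
  assumes "A \<longlonglongrightarrow> B" "\<forall>\<^sub>F n in sequentially. positive_op (A n)" "positive_op B"
  shows "(\<lambda>n. op_sqrt (A n)) \<longlonglongrightarrow> op_sqrt B"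
proof -
  have "(\<lambda>n. sqrt (norm (A n - B))) \<longlonglongrightarrow> 0"
    using assms(1) by (auto intro!: tendsto_eq_intros simp: LIM_zero_iff tendsto_norm_zero_iff)
  moreover have "\<forall>\<^sub>F n in sequentially. norm (op_sqrt (A n) - op_sqrt B) \<le> sqrt (norm (A n - B))"
    using assms(2)
  proof eventually_elim
    case (elim n)
    then have "(norm (op_sqrt (A n) - op_sqrt B))\<^sup>2 \<le> norm (A n - B)"
      using norm_positive_op_diff_le[of "op_sqrt (A n)" "op_sqrt B"] op_sqrt[OF elim] op_sqrt[OF assms(3)]
      by simp
    then show ?case by (rule real_le_rsqrt)
  qed
  ultimately have "(\<lambda>n. op_sqrt (A n) - op_sqrt B) \<longlonglongrightarrow> 0" by (rule Lim_null_comparison[rotated])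
  then show ?thesis by (simp add: LIM_zero_iff)
qed

section \<open>The joint polar decomposition\<close>

text \<open>\<open>V\<close> comes from \<open>blinfun_factor\<close> and \<open>U\<close> is its
  adjoint. Values of \<open>V\<close> lie in the closure of the range of \<open>P\<close>, which is
  orthogonal to the kernel of the self-adjoint \<open>P\<close>, so \<open>U\<close> vanishes on
  that kernel. \<open>V\<close> is part of the result because the joint kernel identity is proved
  through it.\<close>

lemma polar_factor_exists:
  fixes T P :: "'a::chilbert_space \<Rightarrow>\<^sub>L 'a"
  assumes T: "clinear_op T" and P: "positive_op P" and le: "\<And>x. norm (T x) \<le> norm (P x)"
  obtains U V where "clinear_op U" "T = (U o\<^sub>L P)" "norm U \<le> 1"
    "\<And>x. P x = 0 \<Longrightarrow> U x = 0"
    "\<And>x y. inner (U x) y = inner x (V y)" "\<And>y. V y \<in> closure (range P)"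
proof -
  obtain V :: "'a \<Rightarrow>\<^sub>L 'a" where V: "\<And>x y. inner (T x) y = inner (P x) (V y)"
    "\<And>y. V y \<in> closure (range P)" "norm V \<le> 1"
    using blinfun_factor[of T 1 P] le by auto
  obtain U :: "'a \<Rightarrow>\<^sub>L 'a" where U: "\<And>x y. inner (V x) y = inner x (U y)"
    using real_adjoint_exists by blast
  have UV: "inner (U x) y = inner x (V y)" for x y
    using U[of y x] by (simp add: inner_commute)
  have P': "clinear_op P" "blinfun_selfadjoint P" using P by (auto simp: positive_op_iff)
  \<comment> \<open>The closure of the range of \<open>P\<close> is stable under complex scalars, so
    uniqueness of representatives gives complex linearity.\<close>
  have "V (c *\<^sub>C y) - c *\<^sub>C V y = 0" for c y
  proof (rule orthogonal_in_closure_range_eq_0)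
    have "(\<lambda>x. c *\<^sub>C x) ` closure (range P) \<subseteq> closure (range P)"
    proof (rule image_closure_subset)
      show "continuous_on (closure (range P)) (\<lambda>x. c *\<^sub>C x)"
        by (rule linear_continuous_on[OF bounded_linear_scaleC])
      show "(\<lambda>x. c *\<^sub>C x) ` range P \<subseteq> closure (range P)"
      proof
        fix z assume "z \<in> (\<lambda>x. c *\<^sub>C x) ` range P"
        then obtain w where "z = P (c *\<^sub>C w)" using P'(1) by (auto simp: clinear_op_def)
        then show "z \<in> closure (range P)" by (intro subsetD[OF closure_subset]) simp
      qed
    qed simp
    then have "c *\<^sub>C V y \<in> closure (range P)" using V(2) by blast
    moreover have "subspace (closure (range P))"
      by (intro subspace_closure linear_subspace_image subspace_UNIV
          blinfun.bounded_linear_right[THEN bounded_linear.linear])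
    ultimately show "V (c *\<^sub>C y) - c *\<^sub>C V y \<in> closure (range P)"
      using V(2) by (intro subspace_diff)
    show "inner (P z) (V (c *\<^sub>C y) - c *\<^sub>C V y) = 0" for z
    proof -
      have "inner (P z) (c *\<^sub>C V y) = inner (P (cnj c *\<^sub>C z)) (V y)"
        by (simp add: inner_scaleC_right clinear_opD[OF P'(1)])
      also have "\<dots> = inner (T z) (c *\<^sub>C y)"
        by (simp add: inner_scaleC_right clinear_opD[OF T] flip: V(1))
      finally show ?thesis by (simp add: inner_diff_right V(1))
    qed
  qed
  then have "clinear_op V" by (simp add: clinear_op_def)
  then have cU: "clinear_op U" using U by (rule clinear_op_of_adjoint)
  have "T x = U (P x)" for x
  proof -
    have "inner (T x - U (P x)) y = 0" for y by (simp add: inner_diff_left UV V(1))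
    from this[of "T x - U (P x)"] show ?thesis by simp
  qed
  then have TU: "T = (U o\<^sub>L P)" by (intro blinfun_eqI) simp
  have nU: "norm U \<le> 1" using norm_le_of_adjoint[OF U] V(3) by linarith
  have ker: "U x = 0" if "P x = 0" for x
  proof -
    have "inner (V (U x)) x = 0"
    proof (rule inner_closure_range_eq_0[OF V(2)])
      show "inner (P z) x = 0" for z using that by (simp add: blinfun_selfadjointD[OF P'(2)])
    qed
    then show ?thesis by (simp add: U)
  qed
  show ?thesis by (rule that[OF cU TU nU ker UV V(2)])
qed

text \<open>Let \<open>D = U - U'\<close> with adjoint \<open>D'\<close>. As \<open>D\<close> kills
  the range of \<open>P\<close>, the values of \<open>D'\<close> lie in the kernel of
  \<open>P\<close>, where \<open>D\<close> vanishes too. Thus \<open>D D' = 0\<close>, which forces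
  \<open>D'\<close> and then \<open>D\<close> to be 0, with no orthogonal decomposition of the
  space.\<close>

lemma polar_factor_unique:
  fixes U U' P :: "'a::{real_inner,banach} \<Rightarrow>\<^sub>L 'a"
  assumes P: "blinfun_selfadjoint P" and eq: "(U o\<^sub>L P) = (U' o\<^sub>L P)"
    and ker: "\<And>x. P x = 0 \<Longrightarrow> U x = 0 \<and> U' x = 0"
  shows "U = U'"
proof (rule blinfun_eqI)
  fix x
  obtain D' :: "'a \<Rightarrow>\<^sub>L 'a" where D': "\<And>x y. inner ((U - U') x) y = inner x (D' y)"
    using real_adjoint_exists by blast
  have DP: "(U - U') (P z) = 0" for z
    using arg_cong[OF eq, of "\<lambda>Z. Z z"] by (simp add: blinfun.diff_left)
  have "D' y = 0" for y
  proof -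
    have "inner (P (D' y)) z = 0" for z
      using D'[of "P z" y] DP[of z] blinfun_selfadjointD[OF P, of "D' y" z]
      by (simp add: inner_commute)
    then have "P (D' y) = 0" by (metis inner_eq_zero_iff)
    then have "(U - U') (D' y) = 0" using ker by (simp add: blinfun.diff_left)
    then show ?thesis using D'[of "D' y" y] by simp
  qed
  then have "inner ((U - U') x) ((U - U') x) = 0" by (simp add: D')
  then show "U x = U' x" by (simp add: blinfun.diff_left)
qed

lemma inner_op_adjoint_compose:
  assumes "clinear_op T"
  shows "inner ((op_adjoint T o\<^sub>L T) x) y = inner (T x) (T y)"
  using inner_op_adjoint[OF assms, of y "T x"] by (simp add: inner_commute)

lemma clinear_op_adjoint: "clinear_op T \<Longrightarrow> clinear_op (op_adjoint T)"
  using clinear_op_of_adjoint[of T "op_adjoint T"] inner_op_adjoint by blast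

lemma positive_op_spherical_square:
  assumes "clinear_op T1" "clinear_op T2"
  shows "positive_op ((op_adjoint T1 o\<^sub>L T1) + (op_adjoint T2 o\<^sub>L T2))"
proof -
  define G where "G = (op_adjoint T1 o\<^sub>L T1) + (op_adjoint T2 o\<^sub>L T2)"
  have form: "inner (G x) y = inner (T1 x) (T1 y) + inner (T2 x) (T2 y)" for x y
    unfolding G_def blinfun.add_left inner_add_left
    by (simp only: inner_op_adjoint_compose[OF assms(1)] inner_op_adjoint_compose[OF assms(2)])
  have "clinear_op G"
    unfolding G_def by (intro clinear_op_add clinear_op_compose clinear_op_adjoint assms)
  moreover have "inner (G x) y = inner x (G y)" for x y
    using form[of x y] form[of y x] by (simp add: inner_commute)
  moreover have "0 \<le> inner (G x) x" for x by (simp add: form)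
  ultimately have "positive_op G" unfolding positive_op_iff blinfun_selfadjoint_def by blast
  then show ?thesis by (simp only: G_def)
qed

lemma spherical_modulus:
  assumes "clinear_op T1" "clinear_op T2"
  shows "positive_op (spherical_modulus T1 T2)"
    and "inner (spherical_modulus T1 T2 x) (spherical_modulus T1 T2 y)
      = inner (T1 x) (T1 y) + inner (T2 x) (T2 y)"
proof -
  let ?P = "spherical_modulus T1 T2"
  let ?G = "(op_adjoint T1 o\<^sub>L T1) + (op_adjoint T2 o\<^sub>L T2)"
  show P: "positive_op ?P"
    unfolding spherical_modulus_def by (intro op_sqrt positive_op_spherical_square assms)
  have sq: "(?P o\<^sub>L ?P) = ?G"
    unfolding spherical_modulus_def by (intro op_sqrt positive_op_spherical_square assms)
  have "inner (?P x) (?P y) = inner ((?P o\<^sub>L ?P) x) y"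
    using P by (simp add: positive_op_iff blinfun_selfadjointD)
  also have "\<dots> = inner (T1 x) (T1 y) + inner (T2 x) (T2 y)"
    unfolding sq blinfun.add_left inner_add_left
    by (simp only: inner_op_adjoint_compose[OF assms(1)] inner_op_adjoint_compose[OF assms(2)])
  finally show "inner (?P x) (?P y) = inner (T1 x) (T1 y) + inner (T2 x) (T2 y)" .
qed

lemma norm_le_spherical_modulus:
  assumes "clinear_op T1" "clinear_op T2"
  shows "norm (T1 x) \<le> norm (spherical_modulus T1 T2 x)"
    and "norm (T2 x) \<le> norm (spherical_modulus T1 T2 x)"
  using spherical_modulus(2)[OF assms, of x x] by (auto simp: norm_le)

text \<open>The two factors are built separately, each vanishing on the kernel of the modulus. The
  projection identity below shows that their common kernel is no larger. Conversely, the joint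
  kernel condition makes both components of any competitor vanish there, so uniqueness applies to
  each component.\<close>

lemma joint_polar_part:
  assumes T: "clinear_op T1" "clinear_op T2"
  shows "T1 = (fst (joint_polar_part T1 T2) o\<^sub>L spherical_modulus T1 T2)"
    and "T2 = (snd (joint_polar_part T1 T2) o\<^sub>L spherical_modulus T1 T2)"
    and "norm (fst (joint_polar_part T1 T2)) \<le> 1"
    and "norm (snd (joint_polar_part T1 T2)) \<le> 1"
proof -
  define P where "P = spherical_modulus T1 T2"
  note P = spherical_modulus[OF T, folded P_def]
  have P': "blinfun_selfadjoint P" using P(1) by (simp add: positive_op_iff)
  obtain U1 V1 where U1: "clinear_op U1" "T1 = (U1 o\<^sub>L P)" "norm U1 \<le> 1"
    "\<And>x. P x = 0 \<Longrightarrow> U1 x = 0"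
    "\<And>x y. inner (U1 x) y = inner x (V1 y)" "\<And>y. V1 y \<in> closure (range P)"
    using polar_factor_exists[OF T(1) P(1)] norm_le_spherical_modulus(1)[OF T]
    unfolding P_def by metis
  obtain U2 V2 where U2: "clinear_op U2" "T2 = (U2 o\<^sub>L P)" "norm U2 \<le> 1"
    "\<And>x. P x = 0 \<Longrightarrow> U2 x = 0"
    "\<And>x y. inner (U2 x) y = inner x (V2 y)" "\<And>y. V2 y \<in> closure (range P)"
    using polar_factor_exists[OF T(2) P(1)] norm_le_spherical_modulus(2)[OF T]
    unfolding P_def by metis
  have TU: "U1 (P x) = T1 x" "U2 (P x) = T2 x" for x by (simp_all add: U1(2) U2(2))
  have sub: "subspace (closure (range P))"
    by (intro subspace_closure linear_subspace_image subspace_UNIV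
        blinfun.bounded_linear_right[THEN bounded_linear.linear])
  \<comment> \<open>\<open>V1 U1 + V2 U2\<close> is the orthogonal projection onto the closure of the range of \<open>P\<close>.\<close>
  have proj: "V1 (U1 (P w)) + V2 (U2 (P w)) - P w = 0" for w
  proof (rule orthogonal_in_closure_range_eq_0)
    have "P w \<in> closure (range P)" by (intro subsetD[OF closure_subset]) simp
    then show "V1 (U1 (P w)) + V2 (U2 (P w)) - P w \<in> closure (range P)"
      by (intro subspace_diff subspace_add sub U1(6) U2(6))
    show "inner (P z) (V1 (U1 (P w)) + V2 (U2 (P w)) - P w) = 0" for z
      by (simp add: inner_diff_right inner_add_right P(2) TU flip: U1(5) U2(5))
  qed
  have ker: "op_ker U1 \<inter> op_ker U2 = op_ker P"
  proof (intro subset_antisym subsetI)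
    fix x assume "x \<in> op_ker U1 \<inter> op_ker U2"
    then have x: "U1 x = 0" "U2 x = 0" by (auto simp: op_ker_def)
    \<comment> \<open>Apply the projection identity to \<open>P (P x)\<close> and move
      \<open>V1\<close> and \<open>V2\<close> across the inner product, where they become
      \<open>U1 x\<close> and \<open>U2 x\<close>, both zero.\<close>
    have "inner (P x) (P x) = inner x (P (P x))" by (rule blinfun_selfadjointD[OF P'])
    also have "P (P x) = V1 (U1 (P (P x))) + V2 (U2 (P (P x)))"
      using proj[of "P x"] by simp
    also have "inner x \<dots> = 0" by (simp add: inner_add_right x flip: U1(5) U2(5))
    finally show "x \<in> op_ker P" by (simp add: op_ker_def)
  qed (use U1(4) U2(4) in \<open>auto simp: op_ker_def\<close>)
  have eq: "joint_polar_part T1 T2 = (U1, U2)"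
    unfolding joint_polar_part_def P_def[symmetric]
  proof (rule the_equality)
    show "clinear_op (fst (U1, U2)) \<and> clinear_op (snd (U1, U2)) \<and>
      T1 = fst (U1, U2) o\<^sub>L P \<and> T2 = snd (U1, U2) o\<^sub>L P \<and>
      op_ker (fst (U1, U2)) \<inter> op_ker (snd (U1, U2)) = op_ker P"
      using U1(1,2) U2(1,2) ker by simp
    fix W
    assume W: "clinear_op (fst W) \<and> clinear_op (snd W) \<and>
      T1 = fst W o\<^sub>L P \<and> T2 = snd W o\<^sub>L P \<and> op_ker (fst W) \<inter> op_ker (snd W) = op_ker P"
    then have kW: "fst W x = 0 \<and> snd W x = 0" if "P x = 0" for x
      using that by (auto simp: op_ker_def)
    have "fst W = U1"
      by (rule polar_factor_unique[OF P']) (use W U1(2) U1(4) kW in \<open>metis\<close>)+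
    moreover have "snd W = U2"
      by (rule polar_factor_unique[OF P']) (use W U2(2) U2(4) kW in \<open>metis\<close>)+
    ultimately show "W = (U1, U2)" by (simp add: prod_eq_iff)
  qed
  show "T1 = (fst (joint_polar_part T1 T2) o\<^sub>L spherical_modulus T1 T2)"
    "T2 = (snd (joint_polar_part T1 T2) o\<^sub>L spherical_modulus T1 T2)"
    "norm (fst (joint_polar_part T1 T2)) \<le> 1" "norm (snd (joint_polar_part T1 T2)) \<le> 1"
    unfolding P_def[symmetric] eq fst_conv snd_conv by (fact U1(2) U2(2) U1(3) U2(3))+
qed

section \<open>Continuity\<close>

text \<open>For self-adjoint \<open>R\<close>, the product of \<open>E R\<close> and its adjoint is \<open>(E R\<^sup>2) F\<close>, where \<open>F\<close> is
  the adjoint of \<open>E\<close>.\<close>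

lemma norm_compose_selfadjoint_power2_le:
  fixes E R :: "'a::{real_inner,banach} \<Rightarrow>\<^sub>L 'a"
  assumes R: "blinfun_selfadjoint R"
  shows "(norm (E o\<^sub>L R))\<^sup>2 \<le> norm (E o\<^sub>L (R o\<^sub>L R)) * norm E"
proof -
  obtain F :: "'a \<Rightarrow>\<^sub>L 'a" where F: "\<And>x y. inner (E x) y = inner x (F y)"
    using real_adjoint_exists by blast
  let ?q = "norm (E o\<^sub>L (R o\<^sub>L R)) * norm E"
  \<comment> \<open>\<open>R F\<close> and \<open>E R\<close> are adjoint to each other.\<close>
  have "norm (E o\<^sub>L R) \<le> norm (R o\<^sub>L F)"
    by (rule norm_le_of_adjoint)
      (metis F R blinfun_apply_blinfun_compose blinfun_selfadjointD inner_commute)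
  also have "\<dots> \<le> sqrt ?q"
  proof (rule norm_blinfun_bound)
    fix y
    have "(norm (R (F y)))\<^sup>2 = inner ((E o\<^sub>L (R o\<^sub>L R)) (F y)) y"
      by (simp add: power2_norm_eq_inner F blinfun_selfadjointD[OF R])
    also have "\<dots> \<le> norm ((E o\<^sub>L (R o\<^sub>L R)) (F y)) * norm y" by (rule norm_cauchy_schwarz)
    also have "\<dots> \<le> (norm (E o\<^sub>L (R o\<^sub>L R)) * (norm E * norm y)) * norm y"
    proof (rule mult_right_mono)
      have "norm (F y) \<le> norm E * norm y"
        using order_trans[OF norm_blinfun[of F y] mult_right_mono[OF norm_le_of_adjoint[OF F]]] by simp
      then show "norm ((E o\<^sub>L (R o\<^sub>L R)) (F y)) \<le> norm (E o\<^sub>L (R o\<^sub>L R)) * (norm E * norm y)"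
        by (rule order_trans[OF norm_blinfun mult_left_mono]) simp
    qed simp
    finally have "(norm (R (F y)))\<^sup>2 \<le> (sqrt ?q * norm y)\<^sup>2"
      by (simp add: power_mult_distrib power2_eq_square mult_ac)
    then show "norm ((R o\<^sub>L F) y) \<le> sqrt ?q * norm y"
      unfolding blinfun_apply_blinfun_compose by (rule power2_le_imp_le) simp
  qed simp
  finally show ?thesis by (simp add: real_le_rsqrt sqrt_ge_absD)
qed

text \<open>Split \<open>U' R' - U R\<close> into \<open>U' (R' - R)\<close> and
  \<open>(U' - U) R\<close>. The first summand is controlled by the roots since \<open>U'\<close> is
  a contraction. For the second, the preceding lemma trades \<open>R\<close> for \<open>P\<close>,
  on which the polar factors can be compared through \<open>T' - T\<close> and
  \<open>P' - P\<close>; the factor 2 bounds \<open>norm (U' - U)\<close>.\<close>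

lemma norm_polar_factor_root_diff_le:
  fixes U U' P P' R R' T T' :: "'a::{real_inner,banach} \<Rightarrow>\<^sub>L 'a"
  assumes R: "blinfun_selfadjoint R" "(R o\<^sub>L R) = P"
    and T: "T = (U o\<^sub>L P)" "T' = (U' o\<^sub>L P')" and U: "norm U \<le> 1" "norm U' \<le> 1"
  shows "norm ((U' o\<^sub>L R') - (U o\<^sub>L R))
    \<le> norm (R' - R) + sqrt ((norm (T' - T) + norm (P' - P)) * 2)"
proof -
  have compose_le: "norm (U' o\<^sub>L Z) \<le> norm Z" for Z :: "'a \<Rightarrow>\<^sub>L 'a"
    using norm_blinfun_compose[of U' Z] mult_right_mono[OF U(2) norm_ge_zero[of Z]] by linarith
  have "((U' - U) o\<^sub>L P) = (T' - T) - (U' o\<^sub>L (P' - P))"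
    by (simp add: T blinfun_compose.diff_left blinfun_compose.diff_right)
  then have "norm ((U' - U) o\<^sub>L P) \<le> norm (T' - T) + norm (P' - P)"
    using norm_triangle_ineq4[of "T' - T" "U' o\<^sub>L (P' - P)"] compose_le[of "P' - P"] by simp
  moreover have "norm (U' - U) \<le> 2" using norm_triangle_ineq4[of U' U] U by linarith
  ultimately have "norm ((U' - U) o\<^sub>L P) * norm (U' - U) \<le> (norm (T' - T) + norm (P' - P)) * 2"
    by (intro mult_mono) auto
  then have "(norm ((U' - U) o\<^sub>L R))\<^sup>2 \<le> (norm (T' - T) + norm (P' - P)) * 2"
    using norm_compose_selfadjoint_power2_le[OF R(1), of "U' - U"] unfolding R(2) by linarith
  then have "norm ((U' - U) o\<^sub>L R) \<le> sqrt ((norm (T' - T) + norm (P' - P)) * 2)"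
    by (rule real_le_rsqrt)
  moreover have "(U' o\<^sub>L R') - (U o\<^sub>L R) = (U' o\<^sub>L (R' - R)) + ((U' - U) o\<^sub>L R)"
    by (simp add: blinfun_compose.diff_left blinfun_compose.diff_right)
  ultimately show ?thesis
    using norm_triangle_ineq[of "U' o\<^sub>L (R' - R)" "(U' - U) o\<^sub>L R"] compose_le[of "R' - R"] by simp
qed

text \<open>Formulated for a single component, so that it serves both coordinates of the transform.
  No convergence of \<open>U n\<close> is assumed: the product \<open>U n\<close> with
  \<open>R n\<close> converges, and composing with \<open>R n\<close> on the left is jointly
  continuous.\<close>

lemma tendsto_root_polar_root:
  fixes U P R T :: "nat \<Rightarrow> 'a::{real_inner,banach} \<Rightarrow>\<^sub>L 'a"
  assumes lim: "T \<longlonglongrightarrow> T0" "P \<longlonglongrightarrow> P0" "R \<longlonglongrightarrow> R0"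
    and R0: "blinfun_selfadjoint R0" "(R0 o\<^sub>L R0) = P0" and T0: "T0 = (U0 o\<^sub>L P0)" "norm U0 \<le> 1"
    and ev: "\<forall>\<^sub>F n in sequentially. T n = (U n o\<^sub>L P n) \<and> norm (U n) \<le> 1"
  shows "(\<lambda>n. R n o\<^sub>L U n o\<^sub>L R n) \<longlonglongrightarrow> (R0 o\<^sub>L U0 o\<^sub>L R0)"
proof -
  let ?b = "\<lambda>n. norm (R n - R0) + sqrt ((norm (T n - T0) + norm (P n - P0)) * 2)"
  have nl: "(\<lambda>n. norm (T n - T0)) \<longlonglongrightarrow> 0" "(\<lambda>n. norm (P n - P0)) \<longlonglongrightarrow> 0" "(\<lambda>n. norm (R n - R0)) \<longlonglongrightarrow> 0"
    using lim by (simp_all add: LIM_zero_iff tendsto_norm_zero_iff)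
  have "?b \<longlonglongrightarrow> 0 + sqrt ((0 + 0) * 2)" by (intro tendsto_intros nl)
  then have "?b \<longlonglongrightarrow> 0" by simp
  moreover have "\<forall>\<^sub>F n in sequentially. norm ((U n o\<^sub>L R n) - (U0 o\<^sub>L R0)) \<le> ?b n"
    using ev by eventually_elim (use norm_polar_factor_root_diff_le[OF R0 T0(1) _ T0(2)] in blast)
  ultimately have "(\<lambda>n. (U n o\<^sub>L R n) - (U0 o\<^sub>L R0)) \<longlonglongrightarrow> 0" by (rule Lim_null_comparison[rotated])
  then have "(\<lambda>n. U n o\<^sub>L R n) \<longlonglongrightarrow> (U0 o\<^sub>L R0)" by (simp add: LIM_zero_iff)
  with lim(3) have "(\<lambda>n. R n o\<^sub>L (U n o\<^sub>L R n)) \<longlonglongrightarrow> (R0 o\<^sub>L (U0 o\<^sub>L R0))"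
    by (rule blinfun_compose.tendsto)
  moreover have "(X o\<^sub>L (Y o\<^sub>L Z)) = (X o\<^sub>L Y o\<^sub>L Z)" for X Y Z :: "'a \<Rightarrow>\<^sub>L 'a"
    by (rule blinfun_eqI) simp
  ultimately show ?thesis by simp
qed

lemma norm_op_adjoint_diff_le:
  assumes "clinear_op S" "clinear_op T"
  shows "norm (op_adjoint S - op_adjoint T) \<le> norm (S - T)"
  by (rule norm_le_of_adjoint)
    (simp add: blinfun.diff_left inner_diff inner_op_adjoint assms)

lemma tendsto_op_adjoint:
  assumes "S \<longlonglongrightarrow> T" "\<forall>\<^sub>F n in sequentially. clinear_op (S n)" "clinear_op T"
  shows "(\<lambda>n. op_adjoint (S n)) \<longlonglongrightarrow> op_adjoint T"
proof -
  have "(\<lambda>n. norm (S n - T)) \<longlonglongrightarrow> 0"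
    using assms(1) by (simp add: LIM_zero_iff tendsto_norm_zero_iff)
  moreover have "\<forall>\<^sub>F n in sequentially. norm (op_adjoint (S n) - op_adjoint T) \<le> norm (S n - T)"
    using assms(2) by eventually_elim (simp add: norm_op_adjoint_diff_le assms(3))
  ultimately have "(\<lambda>n. op_adjoint (S n) - op_adjoint T) \<longlonglongrightarrow> 0" by (rule Lim_null_comparison[rotated])
  then show ?thesis by (simp add: LIM_zero_iff)
qed

theorem theorem2p9:
  fixes T1 T2 :: "'a::chilbert_space \<Rightarrow>\<^sub>L 'a"
    and S1 S2 :: "nat \<Rightarrow> 'a \<Rightarrow>\<^sub>L 'a"
  assumes "commuting_pair T1 T2"
    and "\<And>n. n \<ge> 1 \<Longrightarrow> commuting_pair (S1 n) (S2 n)"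
    and "(\<lambda>n. norm (S1 n - T1)) \<longlonglongrightarrow> 0"
    and "(\<lambda>n. norm (S2 n - T2)) \<longlonglongrightarrow> 0"
  shows "(\<lambda>n. norm (fst (spherical_aluthge (S1 n) (S2 n)) - fst (spherical_aluthge T1 T2))) \<longlonglongrightarrow> 0
       \<and> (\<lambda>n. norm (snd (spherical_aluthge (S1 n) (S2 n)) - snd (spherical_aluthge T1 T2))) \<longlonglongrightarrow> 0"
proof -
  have T: "clinear_op T1" "clinear_op T2" using assms(1) by (auto simp: commuting_pair_def)
  \<comment> \<open>The pair at index 0 is unconstrained, so properties of the sequences are
    asserted only eventually.\<close>
  have evS: "\<forall>\<^sub>F n in sequentially. clinear_op (S1 n) \<and> clinear_op (S2 n)"
    using eventually_ge_at_top[of 1] by eventually_elim (use assms(2) in \<open>auto simp: commuting_pair_def\<close>)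
  have lim: "S1 \<longlonglongrightarrow> T1" "S2 \<longlonglongrightarrow> T2"
    using assms(3,4) by (simp_all add: LIM_zero_iff tendsto_norm_zero_iff)
  let ?P = "\<lambda>n. spherical_modulus (S1 n) (S2 n)" and ?Q = "spherical_modulus T1 T2"
  have evP: "\<forall>\<^sub>F n in sequentially. positive_op (?P n)"
    using evS by eventually_elim (simp add: spherical_modulus(1))
  have P: "?P \<longlonglongrightarrow> ?Q"
    unfolding spherical_modulus_def
  proof (rule tendsto_op_sqrt)
    show "(\<lambda>n. (op_adjoint (S1 n) o\<^sub>L S1 n) + (op_adjoint (S2 n) o\<^sub>L S2 n))
        \<longlonglongrightarrow> (op_adjoint T1 o\<^sub>L T1) + (op_adjoint T2 o\<^sub>L T2)"
      by (intro tendsto_add blinfun_compose.tendsto tendsto_op_adjoint lim T)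
        (use evS in \<open>auto elim: eventually_mono\<close>)
    show "\<forall>\<^sub>F n in sequentially. positive_op ((op_adjoint (S1 n) o\<^sub>L S1 n) + (op_adjoint (S2 n) o\<^sub>L S2 n))"
      using evS by eventually_elim (simp add: positive_op_spherical_square)
  qed (rule positive_op_spherical_square[OF T])
  note P0 = spherical_modulus(1)[OF T]
  \<comment> \<open>Continuity of the root is used a second time, now on the moduli, which are
    themselves roots.\<close>
  have R: "(\<lambda>n. op_sqrt (?P n)) \<longlonglongrightarrow> op_sqrt ?Q" by (rule tendsto_op_sqrt[OF P evP P0])
  have R0: "blinfun_selfadjoint (op_sqrt ?Q)" using op_sqrt(1)[OF P0] by (simp add: positive_op_iff)
  note polar0 = joint_polar_part[OF T]
  have ev1: "\<forall>\<^sub>F n in sequentially. S1 n = (fst (joint_polar_part (S1 n) (S2 n)) o\<^sub>L ?P n)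
      \<and> norm (fst (joint_polar_part (S1 n) (S2 n))) \<le> 1"
    using evS by eventually_elim (use joint_polar_part in blast)
  have ev2: "\<forall>\<^sub>F n in sequentially. S2 n = (snd (joint_polar_part (S1 n) (S2 n)) o\<^sub>L ?P n)
      \<and> norm (snd (joint_polar_part (S1 n) (S2 n))) \<le> 1"
    using evS by eventually_elim (use joint_polar_part in blast)
  have "(\<lambda>n. fst (spherical_aluthge (S1 n) (S2 n))) \<longlonglongrightarrow> fst (spherical_aluthge T1 T2)"
    unfolding spherical_aluthge_def Let_def fst_conv
    by (rule tendsto_root_polar_root[OF lim(1) P R R0 op_sqrt(2)[OF P0] polar0(1,3) ev1])
  moreover have "(\<lambda>n. snd (spherical_aluthge (S1 n) (S2 n))) \<longlonglongrightarrow> snd (spherical_aluthge T1 T2)"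
    unfolding spherical_aluthge_def Let_def snd_conv
    by (rule tendsto_root_polar_root[OF lim(2) P R R0 op_sqrt(2)[OF P0] polar0(2,4) ev2])
  ultimately show ?thesis by (simp add: LIM_zero_iff tendsto_norm_zero_iff)
qed

end
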